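(* Let $G$ and $H$ be graphs with $\chi(G)<\chi(H)$. Then for all integers $q\geq 2$ there exists a graph $F$ such that $F\rightarrow (G)_q$ and $F\not\rightarrow (H)_q$.
   Context: Graphs are finite and simple. $\chi(G)$ denotes the chromatic number of $G$, i.e. the minimum number of colours in a vertex colouring of $G$ in which no two adjacent vertices receive the same colour. For an integer $q\geq 2$ and graphs $F$ and $G$, $F\rightarrow (G)_q$ ("$F$ is $q$-Ramsey for $G$") means that every colouring of the edges of $F$ in $q$ colours contains a monochromatic copy of $G$, that is, a (not necessarily induced) subgraph of $F$ isomorphic to $G$ all of whose edges have the same colour. $F\not\rightarrow (G)_q$ means that $F$ is not $q$-Ramsey for $G$. *)

theory Defs
  imports "HOL-Library.Ramsey"
begin

datatype 'a ugraph = UGraph (vertex_set: "'a set") (edge_set: "'a set set")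

text \<open>
  An edge is a two-element set of vertices; \<open>nsets V 2\<close> is the set of all two-element
  subsets of \<open>V\<close>.  The graph without vertices is allowed.
\<close>

definition finite_simple_graph :: "'a ugraph \<Rightarrow> bool" where
  "finite_simple_graph G \<longleftrightarrow>
     finite (vertex_set G) \<and> edge_set G \<subseteq> nsets (vertex_set G) 2"

definition proper_vertex_colouring :: "'a ugraph \<Rightarrow> nat \<Rightarrow> ('a \<Rightarrow> nat) \<Rightarrow> bool" where
  "proper_vertex_colouring G k c \<longleftrightarrow>
     c \<in> vertex_set G \<rightarrow> {..<k} \<and>
     (\<forall>u\<in>vertex_set G. \<forall>v\<in>vertex_set G. {u, v} \<in> edge_set G \<longrightarrow> c u \<noteq> c v)"

text \<open>For finite simple graphs the minimum is attained, so \<open>LEAST\<close> is meaningful.\<close>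

definition chromatic_number :: "'a ugraph \<Rightarrow> nat" where
  "chromatic_number G = (LEAST k. \<exists>c. proper_vertex_colouring G k c)"

definition subgraph_of :: "'a ugraph \<Rightarrow> 'a ugraph \<Rightarrow> bool" where
  "subgraph_of S F \<longleftrightarrow>
     finite_simple_graph S \<and> vertex_set S \<subseteq> vertex_set F \<and> edge_set S \<subseteq> edge_set F"

definition graph_isomorphic :: "'a ugraph \<Rightarrow> 'b ugraph \<Rightarrow> bool" where
  "graph_isomorphic G S \<longleftrightarrow>
     (\<exists>f. bij_betw f (vertex_set G) (vertex_set S) \<and>
          (\<forall>u\<in>vertex_set G. \<forall>v\<in>vertex_set G.
             {u, v} \<in> edge_set G \<longleftrightarrow> {f u, f v} \<in> edge_set S))"

text \<open>
  \<open>q_ramsey q F G\<close> is the arrow relation \<open>F \<rightarrow> (G)\<^sub>q\<close>.  A copy of an edgeless \<open>G\<close> is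
  vacuously monochromatic.
\<close>

definition q_ramsey :: "nat \<Rightarrow> 'a ugraph \<Rightarrow> 'b ugraph \<Rightarrow> bool" where
  "q_ramsey q F G \<longleftrightarrow>
     (\<forall>col \<in> edge_set F \<rightarrow> {..<q}.
        \<exists>S. subgraph_of S F \<and> graph_isomorphic G S \<and>
          (\<exists>i<q. \<forall>e\<in>edge_set S. col e = i))"

end

theory Submission
  imports Defs "HOL-Library.Nat_Bijection" "HOL-Combinatorics.Transposition"
begin

text \<open>
  With \<open>k = chromatic_number G\<close>, there are graphs that are \<open>q\<close>-Ramsey for \<open>G\<close> and whose vertex sets
  of size at most \<open>m\<close> all induce \<open>k\<close>-colourable subgraphs; for \<open>m = card (vertex_set H)\<close> such a graph
  does not even contain \<open>H\<close>.  They are obtained by iterating the partite construction of Nesetril and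
  Rodl, starting from a large complete graph: if the base of the construction is Ramsey for the
  clique on \<open>k\<close> vertices and \<open>k\<close>-colourable on sets of size \<open>m\<close>, then the result is
  \<open>k\<close>-colourable on sets of size \<open>m + 1\<close>.  Indeed, such a set projects injectively to the base or is
  coloured from there.  In the injective case each amalgamation glues its pieces along at most one
  vertex in each of two parts whose projections are adjacent in the base, so proper subsets have
  colourings, pulled back from the base, that agree on the common vertices.
\<close>

section \<open>Monochromatic boxes of words and the induced Ramsey theorem for bipartite
  graphs\<close>

definition words :: "nat \<Rightarrow> nat \<Rightarrow> nat list set" where
  "words T M = {s. length s = T \<and> set s \<subseteq> {..<M}}"

lemma finite_words [simp]: "finite (words T M)"
  using finite_lists_length_eq[of "{..<M}" T] by (simp add: words_def conj_commute)

lemma words_mono: "M \<le> M' \<Longrightarrow> words T M \<subseteq> words T M'"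
  by (auto simp: words_def)

lemma box_subset_words:
  assumes "list_all2 (\<in>) s Zs" "length Zs = T" "\<And>Z. Z \<in> set Zs \<Longrightarrow> Z \<subseteq> {..<M}"
  shows "s \<in> words T M"
proof -
  have "set s \<subseteq> {..<M}"
    using assms(1,3) by (induction s Zs rule: list_all2_induct) (auto dest: subsetD)
  then show ?thesis using assms(1,2) by (auto simp: words_def dest: list_all2_lengthD)
qed

text \<open>Induction on the word length. Each first letter is labelled with the whole colouring it
  induces on the remaining letters. There are finitely many labels, so \<open>z\<close> letters
  share one, and the box found for that common colouring is extended by these letters.\<close>

lemma monochromatic_box:
  assumes "finite \<Gamma>"
  shows "\<exists>M. \<forall>col \<in> words T M \<rightarrow> \<Gamma>. \<exists>Zs c. length Zs = T \<and>
           (\<forall>Z\<in>set Zs. Z \<subseteq> {..<M} \<and> card Z = z) \<and> (\<forall>s. list_all2 (\<in>) s Zs \<longrightarrow> col s = c)"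
proof (induction T)
  case 0
  show ?case by (intro exI[of _ 0] ballI) (auto intro: exI[of _ "[]"])
next
  case (Suc T)
  then obtain M where M: "\<And>col. col \<in> words T M \<rightarrow> \<Gamma> \<Longrightarrow> \<exists>Zs c. length Zs = T \<and>
           (\<forall>Z\<in>set Zs. Z \<subseteq> {..<M} \<and> card Z = z) \<and> (\<forall>s. list_all2 (\<in>) s Zs \<longrightarrow> col s = c)"
    by blast
  \<comment> \<open>The labels are extensional functions, so that there are finitely many;
    \<open>tailcol\<close> is restricted to \<open>words T M\<close> for this reason.\<close>
  define \<Delta> where "\<Delta> = words T M \<rightarrow>\<^sub>E \<Gamma>"
  \<comment> \<open>The \<open>max\<close> keeps tails over the smaller alphabet legal; the other
    term exceeds \<open>z * card \<Delta>\<close>, so some label is shared by at least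
    \<open>z\<close> letters.\<close>
  define M' where "M' = max M (z * card \<Delta> + 1)"
  have fin: "finite \<Delta>" using assms by (simp add: \<Delta>_def finite_PiE)
  show ?case
  proof (intro exI[of _ M'] ballI)
    fix col assume col: "col \<in> words (Suc T) M' \<rightarrow> \<Gamma>"
    define tailcol where "tailcol x = restrict (\<lambda>s. col (x # s)) (words T M)" for x
    have tl: "tailcol \<in> {..<M'} \<rightarrow> \<Delta>"
      using col words_mono[of M M' T] by (force simp: \<Delta>_def tailcol_def words_def M'_def)
    moreover have "0 \<in> {..<M'}" by (simp add: M'_def)
    ultimately have ne: "\<Delta> \<noteq> {}" by blast
    obtain y where y: "card (tailcol -` {y} \<inter> {..<M'}) * card \<Delta> \<ge> M'" "y \<in> \<Delta>"
      using pigeonhole_card[OF tl _ fin ne] by auto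
    have "z \<le> card (tailcol -` {y} \<inter> {..<M'})"
    proof (rule ccontr)
      assume "\<not> ?thesis"
      then have "card (tailcol -` {y} \<inter> {..<M'}) * card \<Delta> \<le> z * card \<Delta>" by simp
      moreover have "z * card \<Delta> < M'" by (simp add: M'_def)
      ultimately show False using y(1) by linarith
    qed
    then obtain Z where Z: "Z \<subseteq> tailcol -` {y} \<inter> {..<M'}" "card Z = z"
      by (meson obtain_subset_with_card_n)
    have "y \<in> words T M \<rightarrow> \<Gamma>" using y(2) by (auto simp: \<Delta>_def)
    then obtain Zs c where Zs: "length Zs = T" "\<forall>Z\<in>set Zs. Z \<subseteq> {..<M} \<and> card Z = z"
        "\<forall>s. list_all2 (\<in>) s Zs \<longrightarrow> y s = c"
      using M by blast
    have "col s = c" if s: "list_all2 (\<in>) s (Z # Zs)" for s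
    proof -
      obtain x t where xt: "s = x # t" "x \<in> Z" "list_all2 (\<in>) t Zs"
        using s by (auto simp: list_all2_Cons2)
      have "t \<in> words T M"
        using box_subset_words[OF xt(3) Zs(1)] Zs(2) by blast
      moreover have "tailcol x = y" using xt Z by auto
      ultimately have "col (x # t) = y t" by (auto simp: tailcol_def)
      then show ?thesis using Zs(3) xt by auto
    qed
    moreover have "\<forall>Z'\<in>set (Z # Zs). Z' \<subseteq> {..<M'} \<and> card Z' = z"
      using Z Zs(2) by (auto simp: M'_def less_max_iff_disj dest!: subsetD)
    ultimately show "\<exists>Zs c. length Zs = Suc T \<and>
           (\<forall>Z\<in>set Zs. Z \<subseteq> {..<M'} \<and> card Z = z) \<and> (\<forall>s. list_all2 (\<in>) s Zs \<longrightarrow> col s = c)"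
      using Zs(1) by (intro exI[of _ "Z # Zs"] exI[of _ c]) auto
  qed
qed

text \<open>
  Points \<open>(t, x)\<close> are joined to the words \<open>s\<close> with \<open>s ! t = x\<close>.  On a box the colour of such an edge
  depends only on \<open>t\<close>, and one colour is used by more than \<open>card A\<close> coordinates.  Each vertex of
  \<open>A\<close> gets its own such coordinate, and a spare one keeps the images of \<open>C\<close> apart.
\<close>

lemma bipartite_induced_ramsey:
  fixes A :: "'a set" and C :: "'b set" and q :: nat
  assumes fin: "finite A" "finite C" and q: "q > 0"
  shows "\<exists>(A' :: nat set) (C' :: nat set) B'. finite A' \<and> finite C' \<and> B' \<subseteq> A' \<times> C' \<and>
    (\<forall>col \<in> B' \<rightarrow> {..<q}. \<exists>f g i. i < q \<and> inj_on f A \<and> f ` A \<subseteq> A' \<and> inj_on g C \<and> g ` C \<subseteq> C' \<and>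
       (\<forall>x\<in>A. \<forall>y\<in>C. ((f x, g y) \<in> B' \<longleftrightarrow> (x, y) \<in> B) \<and> ((x, y) \<in> B \<longrightarrow> col (f x, g y) = i)))"
proof -
  \<comment> \<open>Among this many coordinates, \<open>q\<close> colours leave one class with more
    than \<open>card A\<close> members, hence a spare coordinate \<open>t0\<close>.\<close>
  define T where "T = q * card A + 1"
  \<comment> \<open>Room for \<open>card C\<close> distinct letters at \<open>t0\<close> and for two
    distinct letters \<open>\<zeta> t\<close>, \<open>\<eta> t\<close> at every coordinate.\<close>
  define z where "z = card C + 2"
  define \<Gamma> where "\<Gamma> = words T q"
  obtain M where M: "\<And>col. col \<in> words T M \<rightarrow> \<Gamma> \<Longrightarrow> \<exists>Zs c. length Zs = T \<and>
      (\<forall>Z\<in>set Zs. Z \<subseteq> {..<M} \<and> card Z = z) \<and> (\<forall>s. list_all2 (\<in>) s Zs \<longrightarrow> col s = c)"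
    using monochromatic_box[of \<Gamma> T z] by (auto simp: \<Gamma>_def)
  define A' where "A' = prod_encode ` ({..<T} \<times> {..<M})"
  define C' where "C' = list_encode ` words T M"
  define B' where "B' = {(prod_encode (t, s ! t), list_encode s) | s t. t < T \<and> s \<in> words T M}"
  have B'_iff: "(prod_encode (t, x), list_encode s) \<in> B' \<longleftrightarrow> t < T \<and> s \<in> words T M \<and> s ! t = x" for t x s
    by (auto simp: B'_def list_encode_eq)
  show ?thesis
  proof (rule exI[of _ A'], rule exI[of _ C'], rule exI[of _ B'], intro conjI ballI)
    show "finite A'" "finite C'" by (simp_all add: A'_def C'_def)
    show "B' \<subseteq> A' \<times> C'"
      by (force simp: B'_def A'_def C'_def words_def)
    fix col assume col: "col \<in> B' \<rightarrow> {..<q}"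
    \<comment> \<open>All edges at a word are coloured at once, by the list of their
      \<open>T\<close> colours. Once this list is constant on a box, the colour of an edge there
      depends only on its coordinate.\<close>
    define pat where "pat s = map (\<lambda>t. col (prod_encode (t, s ! t), list_encode s)) [0..<T]" for s
    have "pat s \<in> \<Gamma>" if "s \<in> words T M" for s
    proof -
      have "(prod_encode (t, s ! t), list_encode s) \<in> B'" if "t < T" for t
        using \<open>s \<in> words T M\<close> that by (simp add: B'_iff)
      then show ?thesis using col by (fastforce simp: pat_def \<Gamma>_def words_def)
    qed
    then obtain Zs c where Zs: "length Zs = T" "\<And>Z. Z \<in> set Zs \<Longrightarrow> Z \<subseteq> {..<M} \<and> card Z = z"
        "\<And>s. list_all2 (\<in>) s Zs \<Longrightarrow> pat s = c"
      using M[of pat] by auto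
    have Zt: "Zs ! t \<subseteq> {..<M}" "card (Zs ! t) = z" if "t < T" for t
      using Zs(1,2) that by auto
    have "\<exists>u v. u \<in> Zs ! t \<and> v \<in> Zs ! t \<and> u \<noteq> v" if "t < T" for t
    proof -
      have "card (Zs ! t) \<ge> 2" using Zt(2)[OF that] by (simp add: z_def)
      then obtain W where "W \<subseteq> Zs ! t" "card W = 2"
        by (meson obtain_subset_with_card_n)
      then show ?thesis by (auto simp: card_2_iff)
    qed
    then obtain \<zeta> \<eta> where \<zeta>\<eta>: "\<And>t. t < T \<Longrightarrow> \<zeta> t \<in> Zs ! t \<and> \<eta> t \<in> Zs ! t \<and> \<zeta> t \<noteq> \<eta> t"
      by metis
    have box_words: "s \<in> words T M" if "list_all2 (\<in>) s Zs" for s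
      using box_subset_words[OF that Zs(1)] Zs(2) by blast
    \<comment> \<open>The box is not empty, as it contains the word of the letters
      \<open>\<zeta> t\<close>; so \<open>c\<close> is a genuine list of colours.\<close>
    have cq: "c ! t < q" if "t < T" for t
    proof -
      let ?s = "map \<zeta> [0..<T]"
      have s: "list_all2 (\<in>) ?s Zs" using \<zeta>\<eta> Zs(1) by (auto simp: list_all2_conv_all_nth)
      then have "c = pat ?s" using Zs(3) by simp
      moreover have "pat ?s \<in> \<Gamma>" using s box_words \<open>\<And>s. s \<in> words T M \<Longrightarrow> pat s \<in> \<Gamma>\<close> by blast
      ultimately have "c \<in> words T q" by (simp add: \<Gamma>_def)
      then have "length c = T" "set c \<subseteq> {..<q}" by (auto simp: words_def)
      then show ?thesis using that nth_mem[of t c] by blast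
    qed
    have "(\<lambda>t. c ! t) \<in> {..<T} \<rightarrow> {..<q}" using cq by auto
    then obtain i where i: "i < q" "card ((\<lambda>t. c ! t) -` {i} \<inter> {..<T}) * q \<ge> T"
      using pigeonhole_card[of "\<lambda>t. c ! t" "{..<T}" "{..<q}"] q by (auto simp: lessThan_empty_iff)
    define J where "J = {t. t < T \<and> c ! t = i}"
    have J: "J = (\<lambda>t. c ! t) -` {i} \<inter> {..<T}" by (auto simp: J_def)
    have "card A < card J"
    proof (rule ccontr)
      assume "\<not> ?thesis"
      then have "card J * q \<le> card A * q" by simp
      moreover have "card J * q \<ge> T" using i(2) J by simp
      ultimately have "q * card A + 1 \<le> q * card A" unfolding T_def mult.commute[of q] by linarith
      then show False by simp
    qed
    moreover have finJ: "finite J" by (simp add: J_def)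
    ultimately obtain p where p: "p ` A \<subseteq> J" "inj_on p A"
      using fin(1) card_le_inj[of A J] by auto
    have "card (p ` A) < card J" using \<open>card A < card J\<close> p(2) by (simp add: card_image)
    then obtain t0 where t0: "t0 \<in> J" "t0 \<notin> p ` A"
      using card_mono[of "p ` A" J] fin(1) by (meson finite_imageI leD subsetI)
    have "card C \<le> card (Zs ! t0)" "finite (Zs ! t0)"
      using Zt[of t0] t0 finite_subset[of _ "{..<M}"] by (auto simp: J_def z_def)
    then obtain \<iota> where \<iota>: "\<iota> ` C \<subseteq> Zs ! t0" "inj_on \<iota> C"
      using fin(2) card_le_inj[of C "Zs ! t0"] by auto
    \<comment> \<open>In the word of \<open>y\<close>, the letter \<open>\<zeta>\<close> at
      coordinate \<open>p a\<close> encodes adjacency to \<open>a\<close> and \<open>\<eta>\<close>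
      non-adjacency, which makes the copy induced. The letter at \<open>t0\<close> makes
      \<open>g\<close> injective.\<close>
    define f where "f a = prod_encode (p a, \<zeta> (p a))" for a
    define w where "w y = map (\<lambda>t. if t = t0 then \<iota> y else if t \<in> p ` {a\<in>A. (a, y) \<in> B} then \<zeta> t else \<eta> t) [0..<T]" for y
    define g where "g y = list_encode (w y)" for y
    have pT: "p a < T" "c ! p a = i" "p a \<noteq> t0" if "a \<in> A" for a
      using p(1) t0 that by (auto simp: J_def)
    have t0T: "t0 < T" using t0 by (simp add: J_def)
    have box: "list_all2 (\<in>) (w y) Zs" if "y \<in> C" for y
    proof -
      have "w y ! t \<in> Zs ! t" if "t < T" for t
        using that \<open>y \<in> C\<close> \<iota>(1) \<zeta>\<eta>[OF that] by (simp add: w_def image_subset_iff)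
      then show ?thesis using Zs(1) by (simp add: list_all2_conv_all_nth) (simp add: w_def)
    qed
    have wn: "w y ! p x = (if (x, y) \<in> B then \<zeta> (p x) else \<eta> (p x))" if "x \<in> A" for x y
    proof -
      have "p x \<in> p ` {a\<in>A. (a, y) \<in> B} \<longleftrightarrow> (x, y) \<in> B"
        using p(2) that by (auto simp: inj_on_def)
      then show ?thesis using pT[OF that] by (simp add: w_def)
    qed
    show "\<exists>f g i. i < q \<and> inj_on f A \<and> f ` A \<subseteq> A' \<and> inj_on g C \<and> g ` C \<subseteq> C' \<and>
       (\<forall>x\<in>A. \<forall>y\<in>C. ((f x, g y) \<in> B' \<longleftrightarrow> (x, y) \<in> B) \<and> ((x, y) \<in> B \<longrightarrow> col (f x, g y) = i))"
    proof (intro exI conjI ballI impI)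
      show "i < q" by fact
      show "inj_on f A" using p(2) by (auto simp: inj_on_def f_def)
      show "f ` A \<subseteq> A'"
      proof
        fix v assume "v \<in> f ` A"
        then obtain a where a: "a \<in> A" "v = prod_encode (p a, \<zeta> (p a))" by (auto simp: f_def)
        then have "\<zeta> (p a) < M" using pT(1)[of a] \<zeta>\<eta>[of "p a"] Zt(1)[of "p a"] by blast
        then show "v \<in> A'" using a pT(1) by (auto simp: A'_def)
      qed
      show "inj_on g C"
      proof (rule inj_onI)
        fix y y' assume yy: "y \<in> C" "y' \<in> C" "g y = g y'"
        then have "w y ! t0 = w y' ! t0" by (simp add: g_def list_encode_eq)
        then show "y = y'" using yy \<iota>(2) t0T by (auto simp: w_def dest: inj_onD)
      qed
      show "g ` C \<subseteq> C'" using box box_words by (auto simp: g_def C'_def)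
      fix x y assume xy: "x \<in> A" "y \<in> C"
      show iff: "(f x, g y) \<in> B' \<longleftrightarrow> (x, y) \<in> B"
        using xy pT(1)[of x] wn[of x y] box[THEN box_words, of y] \<zeta>\<eta>[of "p x"]
        by (auto simp: f_def g_def B'_iff)
      assume B: "(x, y) \<in> B"
      have "c = pat (w y)" using Zs(3) box xy by simp
      then have "c ! p x = col (prod_encode (p x, w y ! p x), list_encode (w y))"
        using pT xy by (simp add: pat_def)
      then show "col (f x, g y) = i" using wn[of x y] xy B pT by (simp add: f_def g_def)
    qed
  qed
qed

section \<open>Colourability of vertex subsets, embeddings and the Ramsey arrow\<close>

text \<open>\<open>E\<close> need not lie inside \<open>D\<close>: the colouring condition only
  looks at pairs from \<open>D\<close>, so this speaks of the induced subgraph on \<open>D\<close>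
  without restricting \<open>E\<close>.\<close>

abbreviation colourable :: "nat \<Rightarrow> 'a set \<Rightarrow> 'a set set \<Rightarrow> bool" where
  "colourable k D E \<equiv> \<exists>c. proper_vertex_colouring (UGraph D E) k c"

lemma colourable_iff:
  "colourable k D E \<longleftrightarrow>
     (\<exists>c. (\<forall>x\<in>D. c x < k) \<and> (\<forall>x\<in>D. \<forall>y\<in>D. {x, y} \<in> E \<longrightarrow> c x \<noteq> c y))"
  by (auto simp: proper_vertex_colouring_def Pi_iff)

definition locally_colourable :: "nat \<Rightarrow> nat \<Rightarrow> 'a set \<Rightarrow> 'a set set \<Rightarrow> bool" where
  "locally_colourable m k V E \<longleftrightarrow> (\<forall>D\<subseteq>V. finite D \<and> card D \<le> m \<longrightarrow> colourable k D E)"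

definition embeds :: "('a \<Rightarrow> 'b) \<Rightarrow> 'a set \<Rightarrow> 'a set set \<Rightarrow> 'b set \<Rightarrow> 'b set set \<Rightarrow> bool" where
  "embeds f V E V' E' \<longleftrightarrow> inj_on f V \<and> f ` V \<subseteq> V' \<and> (\<forall>e\<in>E. f ` e \<in> E')"

text \<open>A form of \<open>q_ramsey\<close> on bare vertex and edge sets, with an embedding in
  place of a copy, so that embeddings can be composed; \<open>q_ramsey_arrow\<close> translates
  back.\<close>

definition arrow :: "nat \<Rightarrow> 'a set \<Rightarrow> 'a set set \<Rightarrow> 'b set \<Rightarrow> 'b set set \<Rightarrow> bool" where
  "arrow q V' E' V E \<longleftrightarrow>
     (\<forall>col \<in> E' \<rightarrow> {..<q}. \<exists>f i. i < q \<and> embeds f V E V' E' \<and> (\<forall>e\<in>E. col (f ` e) = i))"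

lemma embeds_comp:
  assumes "embeds f V E V' E'" "embeds g V' E' V'' E''"
  shows "embeds (g \<circ> f) V E V'' E''"
proof -
  have "inj_on (g \<circ> f) V"
    using assms by (auto simp: embeds_def intro: comp_inj_on inj_on_subset)
  then show ?thesis using assms by (force simp: embeds_def image_comp[symmetric] simp del: o_apply)
qed

lemma colourable_pullback:
  assumes "\<And>e. e \<in> E \<Longrightarrow> \<pi> ` e \<in> R" "colourable k (\<pi> ` D) R"
  shows "colourable k D E"
proof -
  obtain c where c: "\<And>x. x \<in> D \<Longrightarrow> c (\<pi> x) < k"
    "\<And>x y. x \<in> D \<Longrightarrow> y \<in> D \<Longrightarrow> {\<pi> x, \<pi> y} \<in> R \<Longrightarrow> c (\<pi> x) \<noteq> c (\<pi> y)"
    using assms(2) unfolding colourable_iff by auto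
  have "{\<pi> x, \<pi> y} \<in> R" if "{x, y} \<in> E" for x y
    using assms(1)[OF that] by simp
  with c show ?thesis unfolding colourable_iff by (intro exI[of _ "c \<circ> \<pi>"]) auto
qed

text \<open>The vertex \<open>z\<close> has at most one neighbour in \<open>D\<close>, so one of the
  colours 0 and 1 is free for it after the rest has been coloured.\<close>

lemma colourable_insert:
  assumes "colourable k (D - {z}) E" "k \<ge> 2" and no_loop: "{z, z} \<notin> E"
    and deg: "\<And>u v. u \<in> D \<Longrightarrow> v \<in> D \<Longrightarrow> {z, u} \<in> E \<Longrightarrow> {z, v} \<in> E \<Longrightarrow> u = v"
  shows "colourable k D E"
proof -
  obtain c where c: "\<forall>x\<in>D - {z}. c x < k" "\<forall>x\<in>D - {z}. \<forall>y\<in>D - {z}. {x, y} \<in> E \<longrightarrow> c x \<noteq> c y"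
    using assms(1) unfolding colourable_iff by blast
  obtain i where i: "i < k" "\<And>u. u \<in> D \<Longrightarrow> {z, u} \<in> E \<Longrightarrow> c u \<noteq> i"
  proof (cases "\<exists>u\<in>D. {z, u} \<in> E")
    case True
    then obtain u where u: "u \<in> D" "{z, u} \<in> E" by blast
    define i where "i = (if c u = 0 then 1 else 0 :: nat)"
    have "i < k" "c u \<noteq> i" using \<open>k \<ge> 2\<close> by (auto simp: i_def)
    with u deg show ?thesis by (intro that[of i]) blast+
  next
    case False
    with \<open>k \<ge> 2\<close> show ?thesis by (intro that[of 0]) auto
  qed
  show ?thesis unfolding colourable_iff
  proof (intro exI[of _ "c(z := i)"] conjI ballI impI)
    fix x y assume xy: "x \<in> D" "y \<in> D" "{x, y} \<in> E"
    then have "{y, x} \<in> E" by (simp add: insert_commute)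
    with xy c(2) i(2)[of x] i(2)[of y] no_loop show "(c(z := i)) x \<noteq> (c(z := i)) y"
      by (cases "x = z"; cases "y = z") auto
  qed (use c(1) i(1) in auto)
qed

text \<open>Adjacent \<open>a\<close> and \<open>b\<close> have different colours, which a
  permutation of the colours moves to 0 and 1. Two colourings normalised in this way agree on
  \<open>a\<close> and \<open>b\<close> and can be glued.\<close>

lemma colourable_normalise:
  assumes "colourable k S R" "{a, b} \<in> R" "k \<ge> 2"
  shows "\<exists>c. (\<forall>x\<in>S. c x < k) \<and> (\<forall>x\<in>S. \<forall>y\<in>S. {x, y} \<in> R \<longrightarrow> c x \<noteq> c y) \<and>
             (a \<in> S \<longrightarrow> c a = 0) \<and> (b \<in> S \<longrightarrow> c b = 1)"
proof -
  obtain c where c: "\<forall>x\<in>S. c x < k" "\<forall>x\<in>S. \<forall>y\<in>S. {x, y} \<in> R \<longrightarrow> c x \<noteq> c y"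
    using assms(1) unfolding colourable_iff by blast
  \<comment> \<open>If \<open>a\<close> or \<open>b\<close> is missing from \<open>S\<close>, a
    placeholder colour different from the other one is used.\<close>
  define i where "i = (if a \<in> S then c a else if b \<in> S \<and> c b = 0 then 1 else 0)"
  define j where "j = (if b \<in> S then c b else if i = 0 then 1 else 0)"
  have "a \<in> S \<Longrightarrow> b \<in> S \<Longrightarrow> c a \<noteq> c b" using c(2) assms(2) by blast
  then have ij: "i \<noteq> j" "i < k" "j < k" using c(1) \<open>k \<ge> 2\<close> by (auto simp: i_def j_def)
  \<comment> \<open>The inner transposition sends \<open>i\<close> to 0; the outer one sends the
    resulting image of \<open>j\<close> to 1 and fixes 0, since that image is not 0.\<close>
  define \<sigma> where "\<sigma> = Transposition.transpose 1 (Transposition.transpose 0 i j) \<circ> Transposition.transpose 0 i"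
  have "inj \<sigma>" unfolding \<sigma>_def by (intro inj_compose) auto
  moreover have "\<sigma> n < k" if "n < k" for n
    using that ij \<open>k \<ge> 2\<close> by (auto simp: \<sigma>_def Transposition.transpose_def)
  moreover have "\<sigma> i = 0" "\<sigma> j = 1"
    using ij by (auto simp: \<sigma>_def Transposition.transpose_def)
  ultimately show ?thesis using c
    by (intro exI[of _ "\<sigma> \<circ> c"]) (auto simp: i_def j_def inj_eq)
qed

section \<open>One round of the partite construction over a fixed base graph\<close>

locale base_graph =
  fixes m k q :: nat and U :: "nat set" and R :: "nat set set"
  assumes finite_U: "finite U" and R_edges: "R \<subseteq> nsets U 2"
    and R_local: "locally_colourable m k U R"
    and k_ge_2: "k \<ge> 2" and q_pos: "q > 0"
begin

text \<open>
  The projection of a picture need not be injective.  Sets on which it is not injective are coloured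
  by pulling back from the base graph, so only transversal sets matter.
\<close>

definition picture :: "nat set \<Rightarrow> nat set set \<Rightarrow> (nat \<Rightarrow> nat) \<Rightarrow> bool" where
  "picture V E \<pi> \<longleftrightarrow> finite V \<and> E \<subseteq> nsets V 2 \<and> \<pi> ` V \<subseteq> U \<and> (\<forall>e\<in>E. \<pi> ` e \<in> R) \<and>
     (\<forall>D\<subseteq>V. inj_on \<pi> D \<and> card D \<le> Suc m \<longrightarrow> colourable k D E)"

text \<open>The projection to the base cannot increase cardinality, so a colouring of the image
  exists and is pulled back.\<close>

lemma colourable_small:
  assumes "\<And>e. e \<in> E \<Longrightarrow> \<pi> ` e \<in> R" "\<pi> ` D \<subseteq> U" "finite D" "card D \<le> m"
  shows "colourable k D E"
proof -
  have "card (\<pi> ` D) \<le> m" using card_image_le[of D \<pi>] assms by linarith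
  then have "colourable k (\<pi> ` D) R" using R_local assms by (auto simp: locally_colourable_def)
  then show ?thesis using assms(1) colourable_pullback by blast
qed

text \<open>Different copies share vertices only over \<open>a\<close> and \<open>b\<close>, and a
  transversal \<open>D\<close> has at most one vertex over each. If one copy contains
  \<open>D\<close> outside these two fibres, then either all of \<open>D\<close> lies in it and is
  coloured from the picture, or some vertex with at most one neighbour in \<open>D\<close> can be
  removed. Otherwise \<open>D\<close> is a union of two proper subsets meeting only over
  \<open>a\<close> and \<open>b\<close>, whose base colourings are made to agree there.\<close>

lemma amalgam_transversal:
  fixes h :: "nat \<Rightarrow> nat \<Rightarrow> nat"
  assumes pic: "picture V E \<pi>" and ab: "{a, b} \<in> R"
    and inj: "\<And>s. s < n \<Longrightarrow> inj_on (h s) V"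
    and proj: "\<And>s v. s < n \<Longrightarrow> v \<in> V \<Longrightarrow> \<pi>' (h s v) = \<pi> v"
    and meet: "\<And>s t v w. s < n \<Longrightarrow> t < n \<Longrightarrow> v \<in> V \<Longrightarrow> w \<in> V \<Longrightarrow> h s v = h t w \<Longrightarrow> s \<noteq> t \<Longrightarrow> \<pi> v \<in> {a, b}"
    and E'_def: "E' = (\<Union>s<n. (`) (h s) ` E)"
    and induced: "\<And>s x y. s < n \<Longrightarrow> x \<in> V \<Longrightarrow> y \<in> V \<Longrightarrow> {h s x, h s y} \<in> E' \<Longrightarrow> {x, y} \<in> E"
    and D: "D \<subseteq> (\<Union>s<n. h s ` V)" "inj_on \<pi>' D" "card D \<le> Suc m"
  shows "colourable k D E'"
proof -
  have pic': "finite V" "E \<subseteq> nsets V 2" "\<pi> ` V \<subseteq> U" "\<And>e. e \<in> E \<Longrightarrow> \<pi> ` e \<in> R"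
    using pic by (auto simp: picture_def)
  have no_loop: "{u} \<notin> R" for u using R_edges by (auto simp: nsets_def)
  have D_finite: "finite D" using D(1) pic'(1) by (meson finite_UN finite_imageI finite_lessThan finite_subset)
  have E'_E: "\<exists>t<n. \<exists>x\<in>V. \<exists>y\<in>V. u = h t x \<and> v = h t y \<and> {x, y} \<in> E" if uv: "{u, v} \<in> E'" for u v
  proof -
    obtain t e where te: "t < n" "e \<in> E" "{u, v} = h t ` e" using uv by (auto simp: E'_def)
    then obtain x y where "e = {x, y}" "x \<in> V" "y \<in> V" using pic'(2) nsets2_E by (metis subsetD)
    with te show ?thesis by (auto simp: doubleton_eq_iff) (metis insert_commute)+
  qed
  have E'_R: "\<pi>' ` e \<in> R" if e: "e \<in> E'" for e
  proof -
    obtain t e0 where te: "t < n" "e0 \<in> E" "e = h t ` e0" using e by (auto simp: E'_def)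
    then have "e0 \<subseteq> V" using pic'(2) by (auto simp: nsets_def)
    have "\<pi>' ` e = (\<lambda>v. \<pi>' (h t v)) ` e0" using te by (simp add: image_image)
    also have "\<dots> = \<pi> ` e0" using te proj \<open>e0 \<subseteq> V\<close> by (intro image_cong) auto
    finally have "\<pi>' ` e = \<pi> ` e0" .
    then show ?thesis using pic'(4) te by simp
  qed
  have D_U: "\<pi>' ` D \<subseteq> U" using D(1) proj pic'(3) by fastforce
  have meet': "\<pi>' u \<in> {a, b}" if "u = h t x" "t < n" "x \<in> V" "s < n" "s \<noteq> t" "u \<in> h s ` V" for u s t x
    using that meet[of t s x] proj by auto
  show ?thesis
  proof (cases "\<exists>s<n. \<forall>d\<in>D. \<pi>' d \<notin> {a, b} \<longrightarrow> d \<in> h s ` V")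
    case True
    then obtain s where s: "s < n" "\<And>d. d \<in> D \<Longrightarrow> \<pi>' d \<notin> {a, b} \<Longrightarrow> d \<in> h s ` V" by blast
    show ?thesis
    proof (cases "D \<subseteq> h s ` V")
      case True
      define D0 where "D0 = {v \<in> V. h s v \<in> D}"
      have D0: "D = h s ` D0" using True by (auto simp: D0_def)
      have "inj_on (h s) D0" using inj[OF s(1)] by (rule inj_on_subset) (auto simp: D0_def)
      then have card: "card D0 = card D" by (simp add: D0 card_image)
      have "inj_on \<pi> D0"
      proof (rule inj_onI)
        fix x y assume xy: "x \<in> D0" "y \<in> D0" "\<pi> x = \<pi> y"
        then have "\<pi>' (h s x) = \<pi>' (h s y)" using proj s(1) by (simp add: D0_def)
        then have "h s x = h s y" using D(2) xy by (auto simp: D0_def dest: inj_onD)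
        then show "x = y" using inj[OF s(1)] xy by (auto simp: D0_def dest: inj_onD)
      qed
      then have "colourable k D0 E"
        using pic D(3) card unfolding picture_def by (auto simp: D0_def)
      then obtain c where c: "\<forall>x\<in>D0. c x < k" "\<forall>x\<in>D0. \<forall>y\<in>D0. {x, y} \<in> E \<longrightarrow> c x \<noteq> c y"
        unfolding colourable_iff by blast
      have inv: "the_inv_into V (h s) (h s v) = v" if "v \<in> D0" for v
        using that inj[OF s(1)] by (auto simp: D0_def intro: the_inv_into_f_f)
      show ?thesis unfolding colourable_iff D0
      proof (intro exI[of _ "c \<circ> the_inv_into V (h s)"] conjI ballI impI)
        fix x assume "x \<in> h s ` D0"
        then show "(c \<circ> the_inv_into V (h s)) x < k" using c(1) inv by auto
      next
        fix x y assume xy: "x \<in> h s ` D0" "y \<in> h s ` D0" "{x, y} \<in> E'"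
        then obtain v w where vw: "v \<in> D0" "w \<in> D0" "x = h s v" "y = h s w" by blast
        then have "{v, w} \<in> E" using induced[OF s(1)] xy(3) by (auto simp: D0_def)
        then show "(c \<circ> the_inv_into V (h s)) x \<noteq> (c \<circ> the_inv_into V (h s)) y"
          using vw c(2) inv by simp
      qed
    next
      case False
      then obtain z where z: "z \<in> D" "z \<notin> h s ` V" by blast
      have z_ab: "\<pi>' z \<in> {a, b}" using s z by blast
      \<comment> \<open>An edge at \<open>z\<close> comes from a copy other than \<open>s\<close>. A
        neighbour off the fibres over \<open>a\<close> and \<open>b\<close> would lie in copy
        \<open>s\<close> too, against \<open>meet\<close>; so it lies over whichever of
        \<open>a\<close>, \<open>b\<close> is not below \<open>z\<close>.\<close>
      have nbr: "\<pi>' u \<in> {a, b} \<and> \<pi>' u \<noteq> \<pi>' z" if u: "u \<in> D" "{z, u} \<in> E'" for u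
      proof
        obtain t x y where t: "t < n" "x \<in> V" "y \<in> V" "z = h t x" "u = h t y"
          using E'_E[OF u(2)] by blast
        then have "s \<noteq> t" using z by auto
        then show "\<pi>' u \<in> {a, b}" using meet'[OF t(5,1,3) s(1)] s(2) u(1) by blast
        show "\<pi>' u \<noteq> \<pi>' z" using E'_R[OF u(2)] no_loop by auto
      qed
      show ?thesis
      proof (rule colourable_insert)
        have "card (D - {z}) \<le> m" using z(1) D(3) D_finite by simp
        then show "colourable k (D - {z}) E'"
          using D_U D_finite E'_R by (intro colourable_small[of _ \<pi>']) auto
        show "{z, z} \<notin> E'" using E'_R no_loop by fastforce
        show "u = v" if "u \<in> D" "v \<in> D" "{z, u} \<in> E'" "{z, v} \<in> E'" for u v
          using nbr[of u] nbr[of v] z_ab that by (auto intro: inj_onD[OF D(2)])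
      qed (fact k_ge_2)
    qed
  next
    case False
    show ?thesis
    proof (cases "\<forall>d\<in>D. \<pi>' d \<in> {a, b}")
      case True
      \<comment> \<open>Any copy would satisfy the outer case condition vacuously, so there is no
        copy at all.\<close>
      then have "D = {}" using False D(1) by blast
      then show ?thesis by (auto simp: colourable_iff)
    next
      case nontriv: False
      then obtain d0 where d0: "d0 \<in> D" "\<pi>' d0 \<notin> {a, b}" by blast
      then obtain s where s: "s < n" "d0 \<in> h s ` V" using D(1) by blast
      then obtain d1 where d1: "d1 \<in> D" "\<pi>' d1 \<notin> {a, b}" "d1 \<notin> h s ` V" using False by blast
      \<comment> \<open>\<open>X\<close> and \<open>Y\<close> overlap exactly in the vertices over
        \<open>a\<close> or \<open>b\<close>. As \<open>X\<close> misses \<open>d1\<close> and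
        \<open>Y\<close> misses \<open>d0\<close>, each has at most \<open>m\<close>
        vertices.\<close>
      define X where "X = {d \<in> D. \<pi>' d \<in> {a, b} \<or> d \<in> h s ` V}"
      define Y where "Y = {d \<in> D. \<pi>' d \<in> {a, b} \<or> d \<notin> h s ` V}"
      have small: "colourable k (\<pi>' ` Z) R" if "Z \<subseteq> D - {d}" "d \<in> D" for Z d
      proof -
        have "card Z \<le> card (D - {d})" using that D_finite by (intro card_mono) auto
        also have "\<dots> \<le> m" using that D(3) D_finite by simp
        finally have "card (\<pi>' ` Z) \<le> m"
          using card_image_le[of Z \<pi>'] that D_finite finite_subset by fastforce
        moreover have "finite Z" "\<pi>' ` Z \<subseteq> U" using that D_finite D_U finite_subset by blast+
        ultimately show ?thesis using R_local by (auto simp: locally_colourable_def)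
      qed
      have "X \<subseteq> D - {d1}" "Y \<subseteq> D - {d0}" using d0 d1 s by (auto simp: X_def Y_def)
      then have "colourable k (\<pi>' ` X) R" "colourable k (\<pi>' ` Y) R"
        using small d0(1) d1(1) by blast+
      \<comment> \<open>After normalisation both colourings use 0 over \<open>a\<close> and 1 over
        \<open>b\<close>, so they agree on the overlap.\<close>
      note normal = this[THEN colourable_normalise, OF ab k_ge_2]
      obtain f where f: "\<And>x. x \<in> X \<Longrightarrow> f (\<pi>' x) < k"
        "\<And>x y. x \<in> X \<Longrightarrow> y \<in> X \<Longrightarrow> {\<pi>' x, \<pi>' y} \<in> R \<Longrightarrow> f (\<pi>' x) \<noteq> f (\<pi>' y)"
        "a \<in> \<pi>' ` X \<Longrightarrow> f a = 0" "b \<in> \<pi>' ` X \<Longrightarrow> f b = 1"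
        using normal(1) by auto
      obtain g where g: "\<And>x. x \<in> Y \<Longrightarrow> g (\<pi>' x) < k"
        "\<And>x y. x \<in> Y \<Longrightarrow> y \<in> Y \<Longrightarrow> {\<pi>' x, \<pi>' y} \<in> R \<Longrightarrow> g (\<pi>' x) \<noteq> g (\<pi>' y)"
        "a \<in> \<pi>' ` Y \<Longrightarrow> g a = 0" "b \<in> \<pi>' ` Y \<Longrightarrow> g b = 1"
        using normal(2) by auto
      define c where "c d = (if d \<in> X then f (\<pi>' d) else g (\<pi>' d))" for d
      have cY: "c d = g (\<pi>' d)" if "d \<in> Y" for d
      proof (cases "d \<in> X")
        case True
        then have "\<pi>' d \<in> {a, b}" using that unfolding X_def Y_def by blast
        then consider "\<pi>' d = a" | "\<pi>' d = b" by blast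
        then show ?thesis using True that f(3,4) g(3,4) by cases (force simp: c_def)+
      qed (simp add: c_def)
      have cX: "c d = f (\<pi>' d)" if "d \<in> X" for d using that by (simp add: c_def)
      have XY: "D = X \<union> Y" by (auto simp: X_def Y_def)
      show ?thesis unfolding colourable_iff
      proof (intro exI[of _ c] conjI ballI impI)
        fix x assume "x \<in> D"
        then show "c x < k" using XY cX cY f(1) g(1) by auto
      next
        fix x y assume xy: "x \<in> D" "y \<in> D" "{x, y} \<in> E'"
        have R: "{\<pi>' x, \<pi>' y} \<in> R" using E'_R[OF xy(3)] by simp
        obtain t x0 y0 where t: "t < n" "x0 \<in> V" "y0 \<in> V" "x = h t x0" "y = h t y0"
          using E'_E[OF xy(3)] by blast
        show "c x \<noteq> c y"
        proof (cases "t = s")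
          case True
          then have "x \<in> X" "y \<in> X" using t xy by (auto simp: X_def)
          then show ?thesis using cX f(2) R by simp
        next
          case False
          \<comment> \<open>An end of an edge of copy \<open>t\<close> that also lies in copy
            \<open>s\<close> lies over \<open>a\<close> or \<open>b\<close>; hence no edge crosses
            between \<open>X\<close> and \<open>Y\<close>.\<close>
          then have "x \<in> Y" "y \<in> Y"
            using meet'[OF t(4,1,2) s(1)] meet'[OF t(5,1,3) s(1)] xy by (auto simp: Y_def)
          then show ?thesis using cY g(2) R by simp
        qed
      qed
    qed
  qed
qed


text \<open>The edges over \<open>{a, b}\<close> form a bipartite graph, for which the induced
  bipartite Ramsey theorem provides a host \<open>B'\<close>. A copy of the picture is hung on every
  induced embedding into the host; a colouring of the host then singles out a copy whose edges over
  \<open>{a, b}\<close> have one colour.\<close>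

lemma amalgamate:
  assumes pic: "picture V E \<pi>" and ab: "{a, b} \<in> R"
  shows "\<exists>V' E' \<pi>'. picture V' E' \<pi>' \<and>
    (\<forall>col \<in> E' \<rightarrow> {..<q}. \<exists>h i. i < q \<and> embeds h V E V' E' \<and> (\<forall>v\<in>V. \<pi>' (h v) = \<pi> v) \<and>
       (\<forall>e\<in>E. \<pi> ` e = {a, b} \<longrightarrow> col (h ` e) = i))"
proof -
  have pic': "finite V" "E \<subseteq> nsets V 2" "\<pi> ` V \<subseteq> U" "\<And>e. e \<in> E \<Longrightarrow> \<pi> ` e \<in> R"
    using pic by (auto simp: picture_def)
  have neq: "a \<noteq> b" using ab R_edges by (auto simp: nsets_def)
  define A where "A = {v \<in> V. \<pi> v = a}"
  define C where "C = {v \<in> V. \<pi> v = b}"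
  define B where "B = {(x, y). {x, y} \<in> E}"
  have fin: "finite A" "finite C" using pic'(1) by (auto simp: A_def C_def)
  obtain A' C' :: "nat set" and B' where bip: "finite A'" "finite C'" "B' \<subseteq> A' \<times> C'"
    "\<forall>col \<in> B' \<rightarrow> {..<q}.
       \<exists>f g i. i < q \<and> inj_on f A \<and> f ` A \<subseteq> A' \<and> inj_on g C \<and> g ` C \<subseteq> C' \<and>
       (\<forall>x\<in>A. \<forall>y\<in>C. ((f x, g y) \<in> B' \<longleftrightarrow> (x, y) \<in> B) \<and> ((x, y) \<in> B \<longrightarrow> col (f x, g y) = i))"
    using bipartite_induced_ramsey[OF fin q_pos, of B] by (elim exE conjE) (rule that; assumption)
  \<comment> \<open>Extensional functions again give a finite set, so the embeddings can be indexed
    by numbers below \<open>n\<close>.\<close>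
  define copies where "copies = {(f, g). f \<in> A \<rightarrow>\<^sub>E A' \<and> g \<in> C \<rightarrow>\<^sub>E C' \<and> inj_on f A \<and> inj_on g C \<and>
      (\<forall>x\<in>A. \<forall>y\<in>C. (f x, g y) \<in> B' \<longleftrightarrow> (x, y) \<in> B)}"
  have "finite ((A \<rightarrow>\<^sub>E A') \<times> (C \<rightarrow>\<^sub>E C'))" using fin bip by (intro finite_cartesian_product finite_PiE) auto
  then have "finite copies" by (rule rev_finite_subset) (auto simp: copies_def)
  then obtain n and cp :: "nat \<Rightarrow> (nat \<Rightarrow> nat) \<times> (nat \<Rightarrow> nat)" where cp: "copies = cp ` {i. i < n}"
    using finite_imp_nat_seg_image_inj_on by blast
  define F where "F s = fst (cp s)" for s
  define H where "H s = snd (cp s)" for s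
  have FH: "F s \<in> A \<rightarrow>\<^sub>E A'" "H s \<in> C \<rightarrow>\<^sub>E C'" "inj_on (F s) A" "inj_on (H s) C"
    "\<And>x y. x \<in> A \<Longrightarrow> y \<in> C \<Longrightarrow> (F s x, H s y) \<in> B' \<longleftrightarrow> {x, y} \<in> E" if "s < n" for s
  proof -
    have "(F s, H s) \<in> copies" using cp that by (auto simp: F_def H_def)
    then show "F s \<in> A \<rightarrow>\<^sub>E A'" "H s \<in> C \<rightarrow>\<^sub>E C'" "inj_on (F s) A" "inj_on (H s) C"
      "\<And>x y. x \<in> A \<Longrightarrow> y \<in> C \<Longrightarrow> (F s x, H s y) \<in> B' \<longleftrightarrow> {x, y} \<in> E"
      by (auto simp: copies_def B_def)
  qed
  \<comment> \<open>Tags 0 and 1 mark the two sides of the host, common to all copies; tag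
    \<open>Suc (Suc s)\<close> marks the private vertices of copy \<open>s\<close>. Copies can thus
    meet only over \<open>a\<close> or \<open>b\<close>.\<close>
  define h where "h s v = prod_encode (if \<pi> v = a then (0, F s v) else if \<pi> v = b then (1, H s v)
                                       else (Suc (Suc s), v))" for s v
  define \<pi>' where "\<pi>' x = (case prod_decode x of (t, v) \<Rightarrow> if t = 0 then a else if t = 1 then b else \<pi> v)" for x
  define V' where "V' = (\<Union>s<n. h s ` V)"
  define E' where "E' = (\<Union>s<n. (`) (h s) ` E)"
  have proj: "\<pi>' (h s v) = \<pi> v" for s v by (simp add: \<pi>'_def h_def)
  have inj: "inj_on (h s) V" if s: "s < n" for s
  proof (rule inj_onI)
    fix x y assume xy: "x \<in> V" "y \<in> V" "h s x = h s y"
    then have \<pi>: "\<pi> x = \<pi> y" using proj by metis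
    consider "\<pi> x = a" | "\<pi> x \<noteq> a" "\<pi> x = b" | "\<pi> x \<noteq> a" "\<pi> x \<noteq> b" by blast
    then show "x = y"
    proof cases
      case 1
      with \<pi> xy have "x \<in> A" "y \<in> A" "F s x = F s y" by (simp_all add: A_def h_def)
      then show ?thesis using inj_onD[OF FH(3)[OF s]] by blast
    next
      case 2
      with \<pi> xy have "x \<in> C" "y \<in> C" "H s x = H s y" by (simp_all add: C_def h_def)
      then show ?thesis using inj_onD[OF FH(4)[OF s]] by blast
    next
      case 3
      with \<pi> xy show ?thesis by (simp add: h_def)
    qed
  qed
  have meet: "\<pi> v \<in> {a, b}" if "h s v = h t w" "s \<noteq> t" for s t v w
    using that by (auto simp: h_def split: if_splits)
  have induced: "{x, y} \<in> E" if s: "s < n" "x \<in> V" "y \<in> V" "{h s x, h s y} \<in> E'" for s x y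
  proof -
    obtain t e where te: "t < n" "e \<in> E" "{h s x, h s y} = h t ` e" using s(4) by (auto simp: E'_def)
    then obtain u v where uv: "e = {u, v}" "u \<in> V" "v \<in> V" using pic'(2) nsets2_E by (metis subsetD)
    obtain x' y' where xy': "h s x = h t x'" "h s y = h t y'" "{x', y'} \<in> E" "x' \<in> V" "y' \<in> V"
      using te uv by (auto simp: doubleton_eq_iff insert_commute)
    show ?thesis
    proof (cases "s = t")
      case True
      then show ?thesis using xy' inj[OF s(1)] s by (auto dest: inj_onD)
    next
      case False
      \<comment> \<open>An edge shared by two copies is a pair of the host, and both embeddings are
        induced, so it is an edge in both or in neither.\<close>
      have \<pi>: "\<pi> x = \<pi> x'" "\<pi> y = \<pi> y'" using proj xy'(1,2) by metis+
      have "\<pi> x \<in> {a, b}" "\<pi> y \<in> {a, b}" using meet xy'(1,2) False by metis+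
      moreover have "{\<pi> x, \<pi> y} \<in> R" using pic'(4)[OF xy'(3)] \<pi> by simp
      then have "\<pi> x \<noteq> \<pi> y" using R_edges by (auto simp: nsets_def)
      ultimately consider "\<pi> x = a" "\<pi> y = b" | "\<pi> x = b" "\<pi> y = a" by auto
      then show ?thesis
      proof cases
        case 1
        then have "x \<in> A" "x' \<in> A" "y \<in> C" "y' \<in> C" "F s x = F t x'" "H s y = H t y'"
          using \<pi> xy' s neq by (auto simp: A_def C_def h_def)
        then show ?thesis using FH(5)[OF s(1)] FH(5)[OF te(1)] xy'(3) by metis
      next
        case 2
        then have "y \<in> A" "y' \<in> A" "x \<in> C" "x' \<in> C" "F s y = F t y'" "H s x = H t x'"
          using \<pi> xy' s neq by (auto simp: A_def C_def h_def)
        then show ?thesis using FH(5)[OF s(1)] FH(5)[OF te(1)] xy'(3) by (metis insert_commute)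
      qed
    qed
  qed
  have sub: "e \<subseteq> V" if "e \<in> E" for e using that pic'(2) by (auto simp: nsets_def)
  have proj_img: "\<pi>' ` h s ` e = \<pi> ` e" for s e by (simp add: image_image proj)
  have "picture V' E' \<pi>'"
    unfolding picture_def
  proof (intro conjI allI impI ballI)
    show "finite V'" using pic'(1) by (simp add: V'_def)
    show "E' \<subseteq> nsets V' 2"
    proof
      fix e' assume "e' \<in> E'"
      then obtain s e where se: "s < n" "e \<in> E" "e' = h s ` e" by (auto simp: E'_def)
      have "finite e \<and> card e = 2" using se(2) pic'(2) by (auto simp: nsets_def)
      then show "e' \<in> nsets V' 2"
        using se sub[OF se(2)] inj_on_subset[OF inj[OF se(1)] sub[OF se(2)]]
        by (auto simp: nsets_def V'_def card_image)
    qed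
    show "\<pi>' ` V' \<subseteq> U" using pic'(3) proj by (auto simp: V'_def)
    show "\<pi>' ` e \<in> R" if "e \<in> E'" for e using that pic'(4) by (auto simp: E'_def proj_img)
    show "colourable k D E'" if "D \<subseteq> V'" "inj_on \<pi>' D \<and> card D \<le> Suc m" for D
    proof (rule amalgam_transversal[OF pic ab, of n h \<pi>'])
      show "D \<subseteq> (\<Union>s<n. h s ` V)" "inj_on \<pi>' D" "card D \<le> Suc m" using that by (simp_all add: V'_def)
    qed (simp add: inj, simp add: proj, erule meet, assumption, fact E'_def, erule induced, assumption+)
  qed
  moreover have "\<exists>h i. i < q \<and> embeds h V E V' E' \<and> (\<forall>v\<in>V. \<pi>' (h v) = \<pi> v) \<and>
       (\<forall>e\<in>E. \<pi> ` e = {a, b} \<longrightarrow> col (h ` e) = i)" if col: "col \<in> E' \<rightarrow> {..<q}" for col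
  proof -
    \<comment> \<open>Pairs of \<open>B'\<close> that no copy turns into an edge are not coloured by
      \<open>col\<close>; they receive the default 0, a legal colour by
      \<open>q_pos\<close>.\<close>
    define bcol where "bcol = (\<lambda>(x, y). let e = {prod_encode (0, x), prod_encode (1, y)} in
        if e \<in> E' then col e else 0)"
    have "bcol \<in> B' \<rightarrow> {..<q}" using col q_pos by (auto simp: bcol_def Let_def)
    from bspec[OF bip(4) this] obtain f g i where fg: "i < q" "inj_on f A" "f ` A \<subseteq> A'" "inj_on g C" "g ` C \<subseteq> C'"
       "\<forall>x\<in>A. \<forall>y\<in>C. ((f x, g y) \<in> B' \<longleftrightarrow> (x, y) \<in> B) \<and> ((x, y) \<in> B \<longrightarrow> bcol (f x, g y) = i)"
      by (elim exE conjE) (rule that; assumption)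
    have "(restrict f A, restrict g C) \<in> copies"
      using fg by (auto simp: copies_def)
    then obtain s where s: "s < n" "cp s = (restrict f A, restrict g C)" using cp by auto
    have "embeds (h s) V E V' E'" using inj[OF s(1)] s(1) by (auto simp: embeds_def V'_def E'_def)
    moreover have "col (h s ` e) = i" if e: "e \<in> E" "\<pi> ` e = {a, b}" for e
    proof -
      obtain u v where uv: "e = {u, v}" "u \<in> V" "v \<in> V" using e(1) pic'(2) nsets2_E by (metis subsetD)
      obtain x y where xy: "e = {x, y}" "x \<in> A" "y \<in> C"
        using e(2) uv neq by (auto simp: A_def C_def doubleton_eq_iff)
      then have "h s ` e = {prod_encode (0, f x), prod_encode (1, g y)}"
        using s neq by (auto simp: h_def F_def H_def A_def C_def)
      moreover have "h s ` e \<in> E'" using s(1) e(1) by (auto simp: E'_def)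
      moreover have "bcol (f x, g y) = i" using fg(6) xy(2,3) e(1) xy(1) by (simp add: B_def)
      ultimately show ?thesis by (simp add: bcol_def)
    qed
    ultimately show ?thesis using fg(1) proj by blast
  qed
  ultimately show ?thesis by blast
qed

text \<open>One amalgamation for each base edge in \<open>S\<close>. Earlier gains survive because
  the colouring is pulled back to a copy of the preceding picture and all embeddings respect the
  projections. The colour \<open>i\<close> may still depend on \<open>r\<close>.\<close>

lemma amalgamate_all:
  assumes pic: "picture V E \<pi>" and "finite S" "S \<subseteq> R"
  shows "\<exists>V' E' \<pi>'. picture V' E' \<pi>' \<and>
    (\<forall>col \<in> E' \<rightarrow> {..<q}. \<exists>h. embeds h V E V' E' \<and> (\<forall>v\<in>V. \<pi>' (h v) = \<pi> v) \<and>
       (\<forall>r\<in>S. \<exists>i<q. \<forall>e\<in>E. \<pi> ` e = r \<longrightarrow> col (h ` e) = i))"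
  using assms(2,3)
proof (induction S rule: finite_induct)
  case empty
  have "embeds id V E V E" by (simp add: embeds_def)
  then show ?case using pic by (metis empty_iff id_apply)
next
  case (insert r S)
  then have "S \<subseteq> R" by simp
  from insert.IH[OF this] obtain V1 E1 \<pi>1 where IH: "picture V1 E1 \<pi>1"
    "\<forall>col \<in> E1 \<rightarrow> {..<q}. \<exists>h. embeds h V E V1 E1 \<and> (\<forall>v\<in>V. \<pi>1 (h v) = \<pi> v) \<and>
       (\<forall>r\<in>S. \<exists>i<q. \<forall>e\<in>E. \<pi> ` e = r \<longrightarrow> col (h ` e) = i)"
    by (elim exE conjE) (rule that; assumption)
  obtain a b where ab: "r = {a, b}" "{a, b} \<in> R"
    using insert.prems R_edges by (metis insert_subset nsets2_E subsetD)
  obtain V2 E2 \<pi>2 where 2: "picture V2 E2 \<pi>2"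
    "\<forall>col \<in> E2 \<rightarrow> {..<q}. \<exists>h i. i < q \<and> embeds h V1 E1 V2 E2 \<and> (\<forall>v\<in>V1. \<pi>2 (h v) = \<pi>1 v) \<and>
       (\<forall>e\<in>E1. \<pi>1 ` e = {a, b} \<longrightarrow> col (h ` e) = i)"
    using amalgamate[OF IH(1) ab(2)] by (elim exE conjE) (rule that; assumption)
  have "\<exists>h. embeds h V E V2 E2 \<and> (\<forall>v\<in>V. \<pi>2 (h v) = \<pi> v) \<and>
       (\<forall>r\<in>insert r S. \<exists>i<q. \<forall>e\<in>E. \<pi> ` e = r \<longrightarrow> col (h ` e) = i)"
    if col: "col \<in> E2 \<rightarrow> {..<q}" for col
  proof -
    obtain h i where h: "i < q" "embeds h V1 E1 V2 E2" "\<forall>v\<in>V1. \<pi>2 (h v) = \<pi>1 v"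
      "\<forall>e\<in>E1. \<pi>1 ` e = {a, b} \<longrightarrow> col (h ` e) = i"
      using bspec[OF 2(2) col] by (elim exE conjE) (rule that; assumption)
    \<comment> \<open>The last amalgamation is resolved first: its copy of \<open>V1\<close>
      transports the colouring to \<open>E1\<close>, where the induction hypothesis applies.\<close>
    have *: "(\<lambda>e. col (h ` e)) \<in> E1 \<rightarrow> {..<q}" using col h(2) by (auto simp: embeds_def)
    obtain g where g: "embeds g V E V1 E1" "\<forall>v\<in>V. \<pi>1 (g v) = \<pi> v"
       "\<forall>r\<in>S. \<exists>i<q. \<forall>e\<in>E. \<pi> ` e = r \<longrightarrow> col (h ` g ` e) = i"
      using bspec[OF IH(2) *] by (elim exE conjE) (rule that; assumption)
    have proj: "\<pi>2 (h (g v)) = \<pi> v" if "v \<in> V" for v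
      using that g(1,2) h(3) by (auto simp: embeds_def image_subset_iff)
    have "col (h ` g ` e) = i" if e: "e \<in> E" "\<pi> ` e = {a, b}" for e
    proof -
      have "e \<subseteq> V" using e(1) pic by (auto simp: picture_def nsets_def)
      then have "\<pi>1 ` g ` e = \<pi> ` e" using g(2) by (auto simp: image_image intro!: image_cong)
      moreover have "g ` e \<in> E1" using g(1) e(1) by (simp add: embeds_def)
      ultimately show ?thesis using h(4) e(2) by simp
    qed
    then have "\<forall>r\<in>insert r S. \<exists>i<q. \<forall>e\<in>E. \<pi> ` e = r \<longrightarrow> col (h ` g ` e) = i"
      using g(3) h(1) ab(1) by blast
    then have "\<forall>r\<in>insert r S. \<exists>i<q. \<forall>e\<in>E. \<pi> ` e = r \<longrightarrow> col ((h \<circ> g) ` e) = i"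
      by (simp only: image_comp)
    then show ?thesis using embeds_comp[OF g(1) h(2)] proj by (intro exI[of _ "h \<circ> g"]) auto
  qed
  then show ?case using 2(1) by blast
qed


text \<open>The initial picture: disjoint copies of the graph, one for each labelled
  \<open>k\<close>-clique of the base, with a vertex of colour class \<open>j\<close> placed over
  the \<open>j\<close>-th clique vertex. All of it is \<open>k\<close>-coloured by
  \<open>\<phi>\<close>.\<close>

lemma picture_clique_blowups:
  fixes VG :: "'a set"
  assumes "finite VG" "EG \<subseteq> nsets VG 2" and \<phi>: "proper_vertex_colouring (UGraph VG EG) k \<phi>"
  shows "\<exists>V E \<pi>. picture V E \<pi> \<and> (\<forall>f. embeds f {..<k} (nsets {..<k} 2) U R \<longrightarrow>
           (\<exists>g. embeds g VG EG V E \<and> (\<forall>x\<in>VG. \<pi> (g x) = f (\<phi> x))))"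
proof -
  have \<phi>: "\<And>x. x \<in> VG \<Longrightarrow> \<phi> x < k" "\<And>x y. x \<in> VG \<Longrightarrow> y \<in> VG \<Longrightarrow> {x, y} \<in> EG \<Longrightarrow> \<phi> x \<noteq> \<phi> y"
    using \<phi> by (auto simp: proper_vertex_colouring_def)
  obtain e :: "'a \<Rightarrow> nat" where e: "inj_on e VG"
    using finite_imp_inj_to_nat_seg[OF assms(1)] by blast
  define cliques where "cliques = {f \<in> {..<k} \<rightarrow>\<^sub>E U. embeds f {..<k} (nsets {..<k} 2) U R}"
  have "finite cliques" using finite_U by (simp add: cliques_def finite_PiE)
  then obtain n and K :: "nat \<Rightarrow> nat \<Rightarrow> nat" where K: "cliques = K ` {i. i < n}"
    using finite_imp_nat_seg_image_inj_on by blast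
  have K_emb: "embeds (K s) {..<k} (nsets {..<k} 2) U R" if "s < n" for s
    using K that by (auto simp: cliques_def)
  define g where "g s x = prod_encode (s, e x)" for s x
  \<comment> \<open>The colour under \<open>\<phi>\<close> is recovered from the encoded vertex; it
    says which clique vertex lies below.\<close>
  define col where "col v = \<phi> (the_inv_into VG e (snd (prod_decode v)))" for v
  define \<pi> where "\<pi> v = K (fst (prod_decode v)) (col v)" for v
  define V where "V = (\<Union>s<n. g s ` VG)"
  define E where "E = (\<Union>s<n. (`) (g s) ` EG)"
  have col: "col (g s x) = \<phi> x" if "x \<in> VG" for s x
    using that e by (simp add: col_def g_def the_inv_into_f_f)
  have \<pi>: "\<pi> (g s x) = K s (\<phi> x)" if "x \<in> VG" for s x
    using col[OF that, of s] by (simp add: \<pi>_def g_def)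
  have inj: "inj_on (g s) VG" for s using e by (auto simp: inj_on_def g_def)
  have E_elim: "\<exists>s x y. s < n \<and> d = {g s x, g s y} \<and> x \<in> VG \<and> y \<in> VG \<and> x \<noteq> y \<and> {x, y} \<in> EG"
    if d: "d \<in> E" for d
  proof -
    obtain s d0 where "s < n" "d0 \<in> EG" "d = g s ` d0" using d by (auto simp: E_def)
    moreover then obtain x y where "d0 = {x, y}" "x \<in> VG" "y \<in> VG" "x \<noteq> y"
      using assms(2) nsets2_E by (metis subsetD)
    ultimately show ?thesis by auto
  qed
  have "picture V E \<pi>"
    unfolding picture_def
  proof (intro conjI allI impI ballI)
    show "finite V" using assms(1) by (simp add: V_def)
    show "E \<subseteq> nsets V 2"
    proof
      fix d assume "d \<in> E"
      then obtain s x y where d: "s < n" "d = {g s x, g s y}" "x \<in> VG" "y \<in> VG" "x \<noteq> y"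
        using E_elim by blast
      then have "g s x \<noteq> g s y" using inj by (auto dest: inj_onD)
      then show "d \<in> nsets V 2" using d by (auto simp: V_def)
    qed
    show "\<pi> ` V \<subseteq> U" using K_emb \<pi> \<phi>(1) by (auto simp: V_def embeds_def image_subset_iff)
    show "\<pi> ` d \<in> R" if dE: "d \<in> E" for d
    proof -
      obtain s x y where d: "s < n" "d = {g s x, g s y}" "x \<in> VG" "y \<in> VG" "{x, y} \<in> EG"
        using E_elim[OF dE] by blast
      then have "{\<phi> x, \<phi> y} \<in> nsets {..<k} 2" using \<phi> by simp
      then have "K s ` {\<phi> x, \<phi> y} \<in> R" using K_emb[OF d(1)] unfolding embeds_def by blast
      then show ?thesis using d \<pi> by simp
    qed
    show "colourable k D E" if "D \<subseteq> V" for D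
      unfolding colourable_iff
    proof (intro exI[of _ col] conjI ballI impI)
      fix x assume "x \<in> D" then show "col x < k" using that \<phi>(1) col by (auto simp: V_def)
    next
      fix u v assume "{u, v} \<in> E"
      then obtain s x y where d: "{u, v} = {g s x, g s y}" "x \<in> VG" "y \<in> VG" "{x, y} \<in> EG"
        using E_elim by blast
      then have "col (g s x) \<noteq> col (g s y)" using \<phi>(2) col by simp
      then show "col u \<noteq> col v" using d(1) by (auto simp: doubleton_eq_iff)
    qed
  qed
  moreover have "\<exists>g. embeds g VG EG V E \<and> (\<forall>x\<in>VG. \<pi> (g x) = f (\<phi> x))"
    if f: "embeds f {..<k} (nsets {..<k} 2) U R" for f
  proof -
    have img: "restrict f {..<k} ` d = f ` d" if "d \<in> nsets {..<k} 2" for d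
      using that by (intro image_cong) (auto simp: nsets_def)
    have "embeds (restrict f {..<k}) {..<k} (nsets {..<k} 2) U R"
      using f img by (auto simp: embeds_def)
    moreover have "restrict f {..<k} \<in> {..<k} \<rightarrow>\<^sub>E U" using f by (auto simp: embeds_def)
    ultimately obtain s where s: "s < n" "K s = restrict f {..<k}"
      using K unfolding cliques_def by (smt (verit) imageE mem_Collect_eq)
    have "embeds (g s) VG EG V E" using s(1) inj by (auto simp: embeds_def V_def E_def)
    moreover have "\<pi> (g s x) = f (\<phi> x)" if "x \<in> VG" for x using that \<pi> s(2) \<phi>(1) by simp
    ultimately show ?thesis by blast
  qed
  ultimately show ?thesis by blast
qed

text \<open>Amalgamating the clique blow-ups along all base edges makes the colour of an edge depend
  on its projection only, which colours the base. A monochromatic clique there has a monochromatic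
  copy of the target graph above it. For the local bound, a set of \<open>Suc m\<close> vertices is
  transversal or projects to at most \<open>m\<close> vertices.\<close>

lemma improve_local:
  fixes VG :: "'a set"
  assumes "finite VG" "EG \<subseteq> nsets VG 2" "colourable k VG EG"
    and R_arrow: "arrow q U R {..<k} (nsets {..<k} 2)"
  shows "\<exists>(V :: nat set) E. finite V \<and> E \<subseteq> nsets V 2 \<and> locally_colourable (Suc m) k V E \<and> arrow q V E VG EG"
proof -
  obtain \<phi> where \<phi>: "proper_vertex_colouring (UGraph VG EG) k \<phi>" using assms(3) by blast
  obtain V0 E0 \<pi>0 where P0: "picture V0 E0 \<pi>0"
    "\<forall>f. embeds f {..<k} (nsets {..<k} 2) U R \<longrightarrow>
       (\<exists>g. embeds g VG EG V0 E0 \<and> (\<forall>x\<in>VG. \<pi>0 (g x) = f (\<phi> x)))"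
    using picture_clique_blowups[OF assms(1,2) \<phi>] by (elim exE conjE) (rule that; assumption)
  have "finite R" using R_edges finite_U finite_imp_finite_nsets finite_subset by blast
  obtain V E \<pi> where P: "picture V E \<pi>"
    "\<forall>col \<in> E \<rightarrow> {..<q}. \<exists>h. embeds h V0 E0 V E \<and> (\<forall>v\<in>V0. \<pi> (h v) = \<pi>0 v) \<and>
       (\<forall>r\<in>R. \<exists>i<q. \<forall>e\<in>E0. \<pi>0 ` e = r \<longrightarrow> col (h ` e) = i)"
    using amalgamate_all[OF P0(1) \<open>finite R\<close> order_refl] by (elim exE conjE) (rule that; assumption)
  have "locally_colourable (Suc m) k V E"
    unfolding locally_colourable_def
  proof (intro allI impI)
    fix D assume D: "D \<subseteq> V" "finite D \<and> card D \<le> Suc m"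
    show "colourable k D E"
    proof (cases "inj_on \<pi> D")
      case True
      then show ?thesis using P(1) D unfolding picture_def by blast
    next
      case False
      then have "card (\<pi> ` D) < card D"
        using D(2) by (meson card_image_le eq_card_imp_inj_on le_neq_implies_less)
      then have "card (\<pi> ` D) \<le> m" "finite (\<pi> ` D)" using D(2) by auto
      moreover have "\<pi> ` D \<subseteq> U" using P(1) D by (auto simp: picture_def)
      ultimately have "colourable k (\<pi> ` D) R" using R_local unfolding locally_colourable_def by blast
      then show ?thesis using P(1) by (intro colourable_pullback[of E \<pi> R]) (auto simp: picture_def)
    qed
  qed
  moreover have "arrow q V E VG EG"
    unfolding arrow_def
  proof
    fix col assume "col \<in> E \<rightarrow> {..<q}"
    from bspec[OF P(2) this] obtain h where h: "embeds h V0 E0 V E"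
      "\<forall>r\<in>R. \<exists>i<q. \<forall>e\<in>E0. \<pi>0 ` e = r \<longrightarrow> col (h ` e) = i"
      by (elim exE conjE) (rule that; assumption)
    \<comment> \<open>The induced colouring of the base; a base edge with nothing above it gets some
      colour below \<open>q\<close>.\<close>
    then obtain rcol where rcol: "\<And>r. r \<in> R \<Longrightarrow> rcol r < q"
      "\<And>r e. r \<in> R \<Longrightarrow> e \<in> E0 \<Longrightarrow> \<pi>0 ` e = r \<Longrightarrow> col (h ` e) = rcol r"
      by metis
    then have "rcol \<in> R \<rightarrow> {..<q}" by auto
    then obtain f i where f: "i < q" "embeds f {..<k} (nsets {..<k} 2) U R"
      "\<And>e. e \<in> nsets {..<k} 2 \<Longrightarrow> rcol (f ` e) = i"
      using R_arrow unfolding arrow_def by blast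
    obtain g where g: "embeds g VG EG V0 E0" "\<And>x. x \<in> VG \<Longrightarrow> \<pi>0 (g x) = f (\<phi> x)"
      using P0(2) f(2) by blast
    have "col ((h \<circ> g) ` e) = i" if e: "e \<in> EG" for e
    proof -
      obtain x y where xy: "e = {x, y}" "x \<in> VG" "y \<in> VG" using e assms(2) nsets2_E by (metis subsetD)
      have k: "{\<phi> x, \<phi> y} \<in> nsets {..<k} 2"
        using xy e \<phi> by (auto simp: proper_vertex_colouring_def)
      have "\<pi>0 ` g ` e = f ` {\<phi> x, \<phi> y}" using xy g(2) by simp
      moreover have "f ` {\<phi> x, \<phi> y} \<in> R" using f(2) k unfolding embeds_def by blast
      moreover have "g ` e \<in> E0" using g(1) e by (simp add: embeds_def)
      ultimately have "col (h ` g ` e) = rcol (f ` {\<phi> x, \<phi> y})" using rcol(2) by blast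
      then show ?thesis using f(3)[OF k] by (simp add: image_comp)
    qed
    then show "\<exists>f i. i < q \<and> embeds f VG EG V E \<and> (\<forall>e\<in>EG. col (f ` e) = i)"
      using embeds_comp[OF g(1) h(1)] f(1) by blast
  qed
  ultimately show ?thesis using P(1) unfolding picture_def by blast
qed

end

section \<open>Iteration of the construction, starting from complete graphs\<close>

text \<open>The finite Ramsey theorem for pairs, with all \<open>q\<close> target sizes equal to
  \<open>k\<close>.\<close>

lemma ramsey_complete_graph:
  fixes q k :: nat
  assumes "q > 0"
  shows "\<exists>N::nat. arrow q {..<N} (nsets {..<N} 2) {..<k} (nsets {..<k} 2)"
proof -
  obtain N :: nat where N: "partn_lst {..<N} (replicate q k) 2" using ramsey_full by blast
  have "\<exists>f i. i < q \<and> embeds f {..<k} (nsets {..<k} 2) {..<N} (nsets {..<N} 2) \<and>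
      (\<forall>e\<in>nsets {..<k} 2. col (f ` e) = i)" if col: "col \<in> nsets {..<N} 2 \<rightarrow> {..<q}" for col
  proof -
    have "\<exists>i<q. monochromatic {..<N} (replicate q k ! i) 2 col i"
      using N col by (simp add: partn_lst_def)
    then have "\<exists>i<q. monochromatic {..<N} k 2 col i" by force
    then obtain i W where W: "i < q" "W \<in> nsets {..<N} k" "col ` nsets W 2 \<subseteq> {i}"
      unfolding monochromatic_def by blast
    have "finite W" "card W = k" "W \<subseteq> {..<N}" using W(2) by (auto simp: nsets_def)
    then obtain f where f: "bij_betw f {..<k} W"
      using bij_betw_iff_card[of "{..<k}" W] by auto
    have img: "f ` e \<in> nsets W 2" if e: "e \<in> nsets {..<k} 2" for e
    proof -
      obtain x y where "e = {x, y}" "x < k" "y < k" "x \<noteq> y" using e nsets2_E by (metis lessThan_iff)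
      then show ?thesis using f by (auto simp: bij_betw_def inj_on_def)
    qed
    have "embeds f {..<k} (nsets {..<k} 2) {..<N} (nsets {..<N} 2)"
      using f img \<open>W \<subseteq> {..<N}\<close> nsets_mono[of W "{..<N}" 2] by (auto simp: embeds_def bij_betw_def)
    then show ?thesis using W(1,3) img by blast
  qed
  then show ?thesis unfolding arrow_def by blast
qed

text \<open>Each round takes the \<open>k\<close>-clique itself as target, so its result can serve
  as the next base. Level 0 concerns the empty set only and holds for any graph.\<close>

lemma locally_colourable_ramsey_clique:
  assumes "k \<ge> 2" "q > 0"
  shows "\<exists>(V :: nat set) E. finite V \<and> E \<subseteq> nsets V 2 \<and> locally_colourable m k V E \<and>
           arrow q V E {..<k} (nsets {..<k} 2)"
proof (induction m)
  case 0
  obtain N :: nat where "arrow q {..<N} (nsets {..<N} 2) {..<k} (nsets {..<k} 2)"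
    using ramsey_complete_graph assms(2) by blast
  moreover have "locally_colourable 0 k {..<N} (nsets {..<N} 2)"
    by (auto simp: locally_colourable_def colourable_iff)
  ultimately show ?case by blast
next
  case (Suc m)
  then obtain U R where UR: "finite (U :: nat set)" "R \<subseteq> nsets U 2" "locally_colourable m k U R"
    "arrow q U R {..<k} (nsets {..<k} 2)" by blast
  interpret base_graph m k q U R using UR assms by unfold_locales auto
  have "colourable k {..<k} (nsets {..<k} 2)"
    unfolding colourable_iff by (intro exI[of _ id]) auto
  from improve_local[OF _ order_refl this UR(4)] show ?case by simp
qed

text \<open>One last round over a base that is Ramsey for the \<open>k\<close>-clique replaces the
  clique by the given \<open>k\<close>-colourable graph.\<close>

lemma locally_colourable_ramsey:
  fixes VG :: "'a set"
  assumes "k \<ge> 2" "q > 0" "finite VG" "EG \<subseteq> nsets VG 2" "colourable k VG EG"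
  shows "\<exists>(V :: nat set) E. finite V \<and> E \<subseteq> nsets V 2 \<and> locally_colourable m k V E \<and> arrow q V E VG EG"
proof -
  obtain U R where UR: "finite (U :: nat set)" "R \<subseteq> nsets U 2" "locally_colourable m k U R"
    "arrow q U R {..<k} (nsets {..<k} 2)"
    using locally_colourable_ramsey_clique[OF assms(1,2)] by blast
  interpret base_graph m k q U R using UR assms by unfold_locales auto
  obtain V :: "nat set" and E where V: "finite V" "E \<subseteq> nsets V 2" "locally_colourable (Suc m) k V E"
    "arrow q V E VG EG"
    using improve_local[OF assms(3,4,5) UR(4)] by blast
  then have "locally_colourable m k V E" by (auto simp: locally_colourable_def)
  with V show ?thesis by blast
qed

section \<open>Return to chromatic numbers and \<open>q_ramsey\<close>, and the conclusion\<close>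

text \<open>An injective numbering of the finitely many vertices is a proper colouring, so the
  minimum is attained.\<close>

lemma chromatic_number_colouring:
  assumes "finite_simple_graph G"
  shows "\<exists>c. proper_vertex_colouring G (chromatic_number G) c"
  unfolding chromatic_number_def
proof (rule LeastI_ex)
  obtain e n where e: "e ` vertex_set G = {i. i < (n :: nat)}" "inj_on e (vertex_set G)"
    using finite_imp_inj_to_nat_seg assms unfolding finite_simple_graph_def by metis
  have "proper_vertex_colouring G n e"
    unfolding proper_vertex_colouring_def
  proof (intro conjI ballI impI)
    show "e \<in> vertex_set G \<rightarrow> {..<n}" using e(1) by auto
    fix u v assume uv: "u \<in> vertex_set G" "v \<in> vertex_set G" "{u, v} \<in> edge_set G"
    then have "u \<noteq> v" using assms doubleton_in_nsets_2[of u v] unfolding finite_simple_graph_def by blast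
    then show "e u \<noteq> e v" using e(2) uv by (auto dest: inj_onD)
  qed
  then show "\<exists>k c. proper_vertex_colouring G k c" by blast
qed

lemma q_ramsey_arrow:
  assumes "finite_simple_graph G" "E \<subseteq> nsets V 2" "arrow q V E (vertex_set G) (edge_set G)"
  shows "q_ramsey q (UGraph V E) G"
  unfolding q_ramsey_def
proof
  fix col assume "col \<in> edge_set (UGraph V E) \<rightarrow> {..<q}"
  then obtain f i where f: "i < q" "embeds f (vertex_set G) (edge_set G) V E"
      "\<forall>e\<in>edge_set G. col (f ` e) = i"
    using assms(3) unfolding arrow_def by auto
  have G: "finite (vertex_set G)" "edge_set G \<subseteq> nsets (vertex_set G) 2"
    using assms(1) by (auto simp: finite_simple_graph_def)
  have inj: "inj_on f (vertex_set G)" using f(2) by (simp add: embeds_def)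
  \<comment> \<open>Only images of edges are kept: \<open>f\<close> need not be induced, yet
    \<open>S\<close> has to be isomorphic to \<open>G\<close>.\<close>
  define S where "S = UGraph (f ` vertex_set G) ((`) f ` edge_set G)"
  have S_edges: "f ` e \<in> nsets (f ` vertex_set G) 2" if "e \<in> edge_set G" for e
    using that G(2) inj_on_subset[OF inj, of e] by (auto simp: nsets_def card_image)
  have "subgraph_of S (UGraph V E)"
    using f(2) S_edges G(1) by (auto simp: subgraph_of_def finite_simple_graph_def S_def embeds_def)
  moreover have "graph_isomorphic G S"
    unfolding graph_isomorphic_def
  proof (intro exI[of _ f] conjI ballI)
    show "bij_betw f (vertex_set G) (vertex_set S)" using inj by (simp add: S_def bij_betw_def)
    fix u v assume uv: "u \<in> vertex_set G" "v \<in> vertex_set G"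
    have "{u, v} = e" if "e \<in> edge_set G" "f ` {u, v} = f ` e" for e
      using that uv G(2) inj_on_image_eq_iff[OF inj, of "{u, v}" e] by (auto simp: nsets_def)
    then show "{u, v} \<in> edge_set G \<longleftrightarrow> {f u, f v} \<in> edge_set S"
      by (auto simp: S_def)
  qed
  moreover have "\<forall>e\<in>edge_set S. col e = i" using f(3) by (auto simp: S_def)
  ultimately show "\<exists>S. subgraph_of S (UGraph V E) \<and> graph_isomorphic G S \<and> (\<exists>i<q. \<forall>e\<in>edge_set S. col e = i)"
    using f(1) by blast
qed

text \<open>The graph contains no copy of \<open>H\<close> at all: its vertex set would be small
  enough to be \<open>k\<close>-coloured, and this colouring would transfer to \<open>H\<close>.
  Hence a constant edge colouring suffices.\<close>

lemma not_q_ramsey_if_locally_colourable: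
  assumes "finite_simple_graph H" "k < chromatic_number H" "q > 0"
    and "locally_colourable (card (vertex_set H)) k V E"
  shows "\<not> q_ramsey q (UGraph V E) H"
proof
  assume "q_ramsey q (UGraph V E) H"
  moreover have "(\<lambda>_. 0) \<in> edge_set (UGraph V E) \<rightarrow> {..<q}" using assms(3) by simp
  ultimately obtain S where S: "subgraph_of S (UGraph V E)" "graph_isomorphic H S"
    unfolding q_ramsey_def by blast
  then obtain f where f: "bij_betw f (vertex_set H) (vertex_set S)"
    "\<And>u v. u \<in> vertex_set H \<Longrightarrow> v \<in> vertex_set H \<Longrightarrow> {u, v} \<in> edge_set H \<longleftrightarrow> {f u, f v} \<in> edge_set S"
    unfolding graph_isomorphic_def by blast
  have fV: "f ` vertex_set H = vertex_set S" using f(1) by (simp add: bij_betw_def)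
  have "card (vertex_set S) = card (vertex_set H)" using bij_betw_same_card[OF f(1)] by simp
  then have "colourable k (vertex_set S) E"
    using assms(4) S(1) by (auto simp: locally_colourable_def subgraph_of_def finite_simple_graph_def)
  then obtain c where c: "\<forall>x\<in>vertex_set S. c x < k"
    "\<forall>x\<in>vertex_set S. \<forall>y\<in>vertex_set S. {x, y} \<in> E \<longrightarrow> c x \<noteq> c y"
    unfolding colourable_iff by blast
  have "proper_vertex_colouring H k (c \<circ> f)"
    unfolding proper_vertex_colouring_def
  proof (intro conjI ballI impI)
    show "c \<circ> f \<in> vertex_set H \<rightarrow> {..<k}" using c(1) unfolding fV[symmetric] by auto
    fix u v assume uv: "u \<in> vertex_set H" "v \<in> vertex_set H" "{u, v} \<in> edge_set H"
    then have "{f u, f v} \<in> E" using f(2) S(1) by (auto simp: subgraph_of_def)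
    then show "(c \<circ> f) u \<noteq> (c \<circ> f) v" using c(2) fV uv by auto
  qed
  then have "\<exists>c. proper_vertex_colouring H k c" by blast
  then show False using assms(2) not_less_Least unfolding chromatic_number_def by blast
qed

lemma arrow_edgeless:
  assumes "finite VG" "q > 0"
  shows "\<exists>V :: nat set. finite V \<and> (VG = {} \<longrightarrow> V = {}) \<and> arrow q V {} VG {}"
proof -
  obtain e :: "'a \<Rightarrow> nat" where "inj_on e VG"
    using finite_imp_inj_to_nat_seg[OF assms(1)] by blast
  then have "arrow q (e ` VG) {} VG {}" using assms(2) by (auto simp: arrow_def embeds_def)
  then show ?thesis using assms(1) by (intro exI[of _ "e ` VG"]) auto
qed

theorem theorem7:
  fixes G :: "'a ugraph" and H :: "'b ugraph"
  assumes "finite_simple_graph G" and "finite_simple_graph H"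
    and "chromatic_number G < chromatic_number H"
  shows "\<forall>q\<ge>2. \<exists>F :: nat ugraph.
           finite_simple_graph F \<and> q_ramsey q F G \<and> \<not> q_ramsey q F H"
proof (intro allI impI)
  fix q :: nat assume q: "q \<ge> 2"
  define k where "k = chromatic_number G"
  define m where "m = card (vertex_set H)"
  have G: "finite (vertex_set G)" "edge_set G \<subseteq> nsets (vertex_set G) 2"
    using assms(1) by (auto simp: finite_simple_graph_def)
  obtain c where c: "proper_vertex_colouring G k c"
    using chromatic_number_colouring[OF assms(1)] by (auto simp: k_def)
  obtain k' and V :: "nat set" and E where F: "k' < chromatic_number H" "finite V" "E \<subseteq> nsets V 2"
    "locally_colourable m k' V E" "arrow q V E (vertex_set G) (edge_set G)"
  proof (cases "k \<ge> 2")
    case True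
    have "colourable k (vertex_set G) (edge_set G)" using c by auto
    from locally_colourable_ramsey[OF True _ G this, of q m] q
    obtain V :: "nat set" and E where "finite V" "E \<subseteq> nsets V 2"
      "locally_colourable m k V E" "arrow q V E (vertex_set G) (edge_set G)" by auto
    then show ?thesis using that assms(3) unfolding k_def by blast
  next
    case False
    \<comment> \<open>The ends of an edge would need two colours, but \<open>k\<close> is at most
      1.\<close>
    have "edge_set G = {}"
    proof (rule ccontr)
      assume "edge_set G \<noteq> {}"
      then obtain x y where "{x, y} \<in> edge_set G" "x \<in> vertex_set G" "y \<in> vertex_set G"
        using G(2) by (metis all_not_in_conv nsets2_E subsetD)
      then have "c x < k" "c y < k" "c x \<noteq> c y" using c by (auto simp: proper_vertex_colouring_def)
      then show False using False by linarith
    qed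
    moreover obtain V :: "nat set" where V: "finite V" "vertex_set G = {} \<longrightarrow> V = {}" "arrow q V {} (vertex_set G) {}"
      using arrow_edgeless[OF G(1), of q] q by auto
    \<comment> \<open>The constant colouring needs \<open>k > 0\<close>; a vertex in
      \<open>V\<close> forces one in \<open>G\<close>, and its colour lies below
      \<open>k\<close>.\<close>
    moreover have "locally_colourable m k V {}"
      unfolding locally_colourable_def colourable_iff
    proof (intro allI impI exI[of _ "\<lambda>_. 0"] conjI ballI)
      fix D v assume "D \<subseteq> V" "v \<in> D"
      then obtain x where "x \<in> vertex_set G" using V(2) by blast
      then have "c x < k" using c by (auto simp: proper_vertex_colouring_def)
      then show "0 < k" by simp
    qed auto
    ultimately show ?thesis using that[of k V "{}"] assms(3) by (simp add: k_def)
  qed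
  have "\<not> q_ramsey q (UGraph V E) H"
    using not_q_ramsey_if_locally_colourable[OF assms(2) F(1), of q V E] F(4) q by (simp add: m_def)
  moreover have "q_ramsey q (UGraph V E) G" using q_ramsey_arrow[OF assms(1) F(3,5)] .
  ultimately show "\<exists>F :: nat ugraph. finite_simple_graph F \<and> q_ramsey q F G \<and> \<not> q_ramsey q F H"
    using F(2,3) by (intro exI[of _ "UGraph V E"]) (simp add: finite_simple_graph_def)
qed

end
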